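(* Let $m\in\mathbb{Z}^+$, let $p_1,\dots,p_m,q,r>0$ satisfy $\sum_{j=1}^m p_j=1$, $\frac1q+\frac1r=1$ and $q<2$, let $\theta>0$, and let $v_1,\dots,v_m\in S^1$ be directions. Then the following assertion is false: for every $\varepsilon>0$ there is a constant $C_\varepsilon<\infty$ such that for every $R>1$, every disc $B_R\subset\mathbb{R}^2$ of radius $R$, all $N_1,\dots,N_m\in\mathbb{Z}^+$, and all choices of rectangles $T_{j,n}\subset\mathbb{R}^2$ ($1\le j\le m$, $1\le n\le N_j$) of infinite length and width $1$ such that the direction of $T_{j,n}$ makes an angle $<\theta$ with $v_j$, one has $$\left\|\prod_{j=1}^m\Big(\sum_{n=1}^{N_j}1_{T_{j,n}}\Big)^{p_j}\right\|_{L_x^qL_y^r(B_R)}\le C_\varepsilon R^\varepsilon\prod_{j=1}^m N_j^{p_j}.$$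
   Context: A rectangle of infinite length and width $1$ is a strip, i.e. the closed $\frac12$-neighbourhood of a line in $\mathbb{R}^2$, and its direction is the direction of that line. The mixed norm over $B_R$ is $\|F\|_{L_x^qL_y^r(B_R)}=\left(\int_{\mathbb{R}}\left(\int_{\mathbb{R}}|F(x,y)|^r1_{B_R}(x,y)\,dy\right)^{q/r}dx\right)^{1/q}$. *)

theory Defs
  imports "HOL-Analysis.Analysis"
begin

definition line :: "real \<times> real \<Rightarrow> real \<times> real \<Rightarrow> (real \<times> real) set" where
  "line a u = {a + t *\<^sub>R u | t. True}"

definition strip :: "real \<times> real \<Rightarrow> real \<times> real \<Rightarrow> (real \<times> real) set" where
  "strip a u = {z. infdist z (line a u) \<le> 1/2}"

definition angle :: "real \<times> real \<Rightarrow> real \<times> real \<Rightarrow> real" where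
  "angle u v = arccos ((u \<bullet> v) / (norm u * norm v))"

text \<open>A line determines its unit direction only up to sign.  A set belongs to
  \<open>strips_near \<theta> v\<close> as soon as one of the two choices makes an angle less than \<open>\<theta>\<close> with \<open>v\<close>,
  so the angle meant is the unoriented one between lines.\<close>

definition strips_near :: "real \<Rightarrow> real \<times> real \<Rightarrow> (real \<times> real) set set" where
  "strips_near \<theta> v = {strip a u | a u. u \<in> sphere 0 1 \<and> angle u v < \<theta>}"

text \<open>Real powers with positive exponent on \<open>[0, \<infinity>]\<close>, with the convention \<open>\<infinity>\<close> to the power \<open>p\<close>
  equals \<open>\<infinity>\<close>.\<close>

definition epowr :: "ennreal \<Rightarrow> real \<Rightarrow> ennreal" where
  "epowr x p = (if x = \<infinity> then \<infinity> else ennreal (enn2real x powr p))"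

text \<open>The norm takes values in \<open>[0, \<infinity>]\<close>, so no integrability is presupposed (the Bochner integral
  would be 0 by convention for non-integrable functions).\<close>

definition mixed_norm ::
    "real \<Rightarrow> real \<Rightarrow> (real \<times> real) set \<Rightarrow> (real \<times> real \<Rightarrow> real) \<Rightarrow> ennreal" where
  "mixed_norm q r B F =
     epowr (\<integral>\<^sup>+ x. epowr (\<integral>\<^sup>+ y. ennreal (\<bar>F (x, y)\<bar> powr r * indicator B (x, y)) \<partial>lborel) (q / r)
       \<partial>lborel) (1 / q)"

end

theory Submission
  imports Defs
begin

text \<open>
  Consider the \<open>n\<^sup>2\<close> lattice points \<open>((nk + l)/4, nl/4)\<close> with \<open>0 \<le> k, l < n\<close>.  Their abscissae run
  through \<open>0, 1/4, \<dots>, (n\<^sup>2 - 1)/4\<close> without repetition, so boxes of side \<open>1/4\<close> at these points have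
  mixed norm of order \<open>n\<close> to the power \<open>2/q\<close>.  On the other hand, the lines joining points of the
  lattice in a fixed integer direction \<open>(a, b)\<close> (in lattice coordinates) are indexed by the
  \<open>O(n)\<close> values of \<open>bk - al\<close>, so \<open>O(n)\<close> strips cover all boxes.  In the plane their direction is
  that of \<open>(a + b/n, b)\<close>, which for large \<open>n\<close> is close to \<open>v\<^sub>j\<close> if \<open>(a, b)\<close> was.  Hence the
  estimate would give \<open>2/q \<le> 1 + 2\<epsilon>\<close> with \<open>R = n\<^sup>2\<close>, which is false for small \<open>\<epsilon>\<close> as \<open>q < 2\<close>.
\<close>

section \<open>Extended powers and lower bounds for integrals\<close>

lemma epowr_mono:
  assumes "x \<le> y" "p \<ge> 0"
  shows "epowr x p \<le> epowr y p"
proof (cases "y = \<infinity>")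
  case False
  then have "x \<noteq> \<infinity>" "enn2real x \<le> enn2real y"
    using assms(1) by (auto simp: top_unique less_top intro!: enn2real_mono)
  then show ?thesis
    using False assms(2) by (auto simp: epowr_def intro!: ennreal_leI powr_mono2)
qed (simp add: epowr_def)

lemma epowr_ennreal: "x \<ge> 0 \<Longrightarrow> epowr (ennreal x) p = ennreal (x powr p)"
  by (simp add: epowr_def)

lemma nn_integral_ge_const_on_interval:
  fixes f :: "real \<Rightarrow> ennreal"
  assumes "a \<le> b" "c \<ge> 0" "\<And>x. a \<le> x \<Longrightarrow> x < b \<Longrightarrow> ennreal c \<le> f x"
  shows "ennreal (c * (b - a)) \<le> (\<integral>\<^sup>+ x. f x \<partial>lborel)"
proof -
  have "ennreal (c * (b - a)) = (\<integral>\<^sup>+ x. ennreal c * indicator {a..<b} x \<partial>lborel)"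
    using assms(1,2) by (simp add: nn_integral_cmult_indicator ennreal_mult)
  also have "\<dots> \<le> (\<integral>\<^sup>+ x. f x \<partial>lborel)"
    using assms(3) by (intro nn_integral_mono) (auto simp: indicator_def)
  finally show ?thesis .
qed

section \<open>Integer directions close to a given direction\<close>

text \<open>Trades the arccos condition for an inequality that is continuous and positively
  homogeneous in \<open>u\<close> and \<open>v\<close>, so that limits and rescaling become
  easy.\<close>

lemma angle_less_if_inner_large:
  assumes "\<theta> > 0"
  obtains \<kappa> :: real where "\<kappa> < 1"
    "\<And>u v. u \<bullet> v > \<kappa> * (norm u * norm v) \<Longrightarrow> angle u v < \<theta>"
proof
  \<comment> \<open>The cap at \<open>pi\<close> keeps \<open>\<phi>\<close> in the range where
    \<open>arccos (cos \<phi>) = \<phi>\<close>; \<theta> itself may be larger.\<close>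
  define \<phi> where "\<phi> = min \<theta> pi"
  have \<phi>: "0 < \<phi>" "\<phi> \<le> pi" "\<phi> \<le> \<theta>"
    using assms by (auto simp: \<phi>_def)
  show "cos \<phi> < 1"
    using cos_monotone_0_pi[of 0 \<phi>] \<phi> by simp
  fix u v :: "real \<times> real"
  assume *: "u \<bullet> v > cos \<phi> * (norm u * norm v)"
  then have "u \<noteq> 0" "v \<noteq> 0" by auto
  then have pos: "norm u * norm v > 0" by simp
  define t where "t = (u \<bullet> v) / (norm u * norm v)"
  have "t > cos \<phi>" using * pos by (simp add: t_def pos_less_divide_eq)
  moreover have "t \<le> 1"
    using pos norm_cauchy_schwarz[of u v] by (simp add: t_def pos_divide_le_eq)
  ultimately have "arccos t < arccos (cos \<phi>)"
    by (intro arccos_less_arccos) auto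
  then show "angle u v < \<theta>"
    using \<phi> by (simp add: angle_def t_def arccos_cos)
qed

text \<open>The condition \<open>f u > 0\<close> below is open and holds at \<open>v\<close>, hence
  at a rational point close to \<open>v\<close>; by homogeneity the denominator \<open>K\<close> can
  be cleared. Openness also absorbs the perturbation \<open>b / n\<close>. The vector
  \<open>(a + b / n, b)\<close> is, up to the factor \<open>n / 4\<close>, the displacement in the
  plane when \<open>(k, l)\<close> moves by \<open>(a, b)\<close>.\<close>

lemma ex_integer_direction_near:
  fixes v :: "real \<times> real"
  assumes "v \<in> sphere 0 1" "\<theta> > 0"
  obtains a b :: int where "(a, b) \<noteq> (0, 0)"
    "eventually (\<lambda>n::nat. angle (sgn (real_of_int a + of_int b / real n, of_int b)) v < \<theta>) sequentially"
proof -
  obtain \<kappa> where \<kappa>: "\<kappa> < 1" "\<And>u v. u \<bullet> v > \<kappa> * (norm u * norm v) \<Longrightarrow> angle u v < \<theta>"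
    using angle_less_if_inner_large[OF assms(2)] by blast
  define f where "f u = u \<bullet> v - \<kappa> * norm u" for u
  have nv: "norm v = 1" using assms(1) by simp
  have f_cont: "isCont f u" for u
    unfolding f_def by (intro continuous_intros)
  have f_scale: "f (c *\<^sub>R u) = c * f u" if "c \<ge> 0" for c u
    using that by (simp add: f_def algebra_simps)
  have angle: "angle (sgn u) v < \<theta>" if "f u > 0" for u
  proof -
    have "u \<noteq> 0" using that by (auto simp: f_def)
    then have "f (sgn u) > 0"
      using that by (simp add: sgn_div_norm f_scale)
    then show ?thesis
      using \<kappa>(2)[where u="sgn u" and v=v] nv by (simp add: f_def)
  qed
  have fv: "f v > 0"
    using \<kappa>(1) nv by (simp add: f_def power2_norm_eq_inner[symmetric])
  have lim: "(\<lambda>K::nat. of_int \<lfloor>real K * x\<rfloor> / real K) \<longlonglongrightarrow> x" for x :: real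
  proof (rule tendsto_sandwich)
    show "eventually (\<lambda>K. x - 1 / real K \<le> of_int \<lfloor>real K * x\<rfloor> / real K) sequentially"
      using eventually_gt_at_top[of 0]
    proof eventually_elim
      case (elim K)
      have "real K * x - 1 \<le> of_int \<lfloor>real K * x\<rfloor>" by linarith
      then have "(real K * x - 1) / real K \<le> of_int \<lfloor>real K * x\<rfloor> / real K"
        by (rule divide_right_mono) simp
      then show ?case using elim by (simp add: diff_divide_distrib)
    qed
    show "eventually (\<lambda>K. of_int \<lfloor>real K * x\<rfloor> / real K \<le> x) sequentially"
      using eventually_gt_at_top[of 0]
      by eventually_elim (simp add: pos_divide_le_eq mult.commute)
    show "(\<lambda>K. x - 1 / real K) \<longlonglongrightarrow> x"
      using tendsto_diff[OF tendsto_const[of x] lim_1_over_n] by simp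
  qed auto
  have "(\<lambda>K::nat. (of_int \<lfloor>real K * fst v\<rfloor> / real K, of_int \<lfloor>real K * snd v\<rfloor> / real K)) \<longlonglongrightarrow> (fst v, snd v)"
    by (intro tendsto_Pair lim)
  then have "(\<lambda>K::nat. f (of_int \<lfloor>real K * fst v\<rfloor> / real K, of_int \<lfloor>real K * snd v\<rfloor> / real K)) \<longlonglongrightarrow> f v"
    by (intro isCont_tendsto_compose[OF f_cont]) simp
  from order_tendstoD(1)[OF this fv]
  have "eventually (\<lambda>K::nat. f (of_int \<lfloor>real K * fst v\<rfloor> / real K, of_int \<lfloor>real K * snd v\<rfloor> / real K) > 0 \<and> K > 0) sequentially"
    by (intro eventually_conj eventually_gt_at_top)
  then obtain K :: nat where K: "K > 0"
    "f (of_int \<lfloor>real K * fst v\<rfloor> / real K, of_int \<lfloor>real K * snd v\<rfloor> / real K) > 0"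
    by (metis (mono_tags, lifting) eventually_happens trivial_limit_sequentially)
  define a b where "a = \<lfloor>real K * fst v\<rfloor>" and "b = \<lfloor>real K * snd v\<rfloor>"
  have "f (of_int a, of_int b) = real K * f (of_int a / real K, of_int b / real K)"
    using K(1) f_scale[of "real K" "(of_int a / real K, of_int b / real K)"] by simp
  then have fab: "f (of_int a, of_int b) > 0"
    using K by (simp add: a_def b_def)
  have "(a, b) \<noteq> (0, 0)"
  proof
    assume "(a, b) = (0, 0)"
    then have "f (of_int a, of_int b) = f 0"
      by (simp add: zero_prod_def)
    then show False
      using fab by (simp add: f_def)
  qed
  moreover have "(\<lambda>n::nat. (of_int a + of_int b * (1 / real n), of_int b :: real)) \<longlonglongrightarrow> (of_int a + of_int b * 0, of_int b)"
    by (intro tendsto_intros lim_1_over_n)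
  then have "(\<lambda>n::nat. f (of_int a + of_int b * (1 / real n), of_int b)) \<longlonglongrightarrow> f (of_int a, of_int b)"
    by (intro isCont_tendsto_compose[OF f_cont]) simp
  from order_tendstoD(1)[OF this fab]
  have "eventually (\<lambda>n::nat. angle (sgn (real_of_int a + of_int b / real n, of_int b)) v < \<theta>) sequentially"
    by eventually_elim (use angle in simp)
  ultimately show ?thesis using that by blast
qed

section \<open>The lattice: covering by strips and the norm of the boxes\<close>

text \<open>The base point depends on \<open>k\<close> and \<open>l\<close> only through
  \<open>b * k - a * l\<close>, so one strip serves all lattice points with the same value; counting
  strips means counting these values.\<close>

lemma strip_lattice_point:
  fixes a b k l :: int and n :: nat
  assumes ab: "(a, b) \<noteq> (0, 0)" and "n > 0"
    and "\<bar>x - of_int (int n * k + l) / 4\<bar> \<le> 1/4" "\<bar>y - of_int (int n * l) / 4\<bar> \<le> 1/4"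
  shows "(x, y) \<in> strip
    ((of_int (b * k - a * l) / of_int (4 * (a\<^sup>2 + b\<^sup>2))) *\<^sub>R (of_int (int n * b - a), of_int (- int n * a)))
    (sgn (of_int a + of_int b / real n, of_int b))"
proof -
  define s where "s = real_of_int (a\<^sup>2 + b\<^sup>2)"
  have "s \<noteq> 0" using ab by (simp add: s_def flip: of_int_power of_int_add)
  define w where "w = (of_int (b * k - a * l) / of_int (4 * (a\<^sup>2 + b\<^sup>2))) *\<^sub>R
    (real_of_int (int n * b - a), real_of_int (- int n * a))"
  define d where "d = (of_int a + of_int b / real n, real_of_int b)"
  define z where "z = (real_of_int (int n * k + l) / 4, real_of_int (int n * l) / 4)"
  have "d \<noteq> 0" using ab by (auto simp: d_def zero_prod_def)
  have "z = w + (of_int (k * a + l * b) * real n / (4 * s)) *\<^sub>R d"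
  proof -
    \<comment> \<open>Orthogonal decomposition in lattice coordinates:
      \<open>s * (k, l) = h * (b, -a) + e * (a, b)\<close>. Applying the map \<open>(k, l)\<close>
      to \<open>(n * k + l, n * l)\<close> gives the two identities; the \<open>h\<close> part
      becomes \<open>w\<close> and the \<open>e\<close> part a multiple of \<open>d\<close>.\<close>
    define h e where "h = real_of_int (b * k - a * l)" and "e = real_of_int (k * a + l * b)"
    have "s * of_int (int n * k + l) = h * of_int (int n * b - a) + e * (real n * of_int a + of_int b)"
      "s * of_int (int n * l) = h * of_int (- int n * a) + e * (real n * of_int b)"
      by (simp_all add: s_def h_def e_def algebra_simps power2_eq_square)
    moreover have "real n * (of_int a + of_int b / real n) = real n * of_int a + of_int b"
      using \<open>n > 0\<close> by (simp add: field_simps)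
    moreover have "u / 4 = h / (4 * s) * u' + e * real n / (4 * s) * u''"
      if "s * u = h * u' + e * (real n * u'')" for u u' u''
      using that \<open>s \<noteq> 0\<close> by (simp add: field_simps)
    ultimately have "of_int (int n * k + l) / 4 =
        h / (4 * s) * of_int (int n * b - a) + e * real n / (4 * s) * (of_int a + of_int b / real n)"
      "of_int (int n * l) / 4 = h / (4 * s) * of_int (- int n * a) + e * real n / (4 * s) * of_int b"
      by (simp_all only:)
    then show ?thesis
      unfolding z_def w_def d_def h_def[symmetric] e_def[symmetric]
      by (simp add: s_def)
  qed
  also have "\<dots> = w + (of_int (k * a + l * b) * real n / (4 * s) * norm d) *\<^sub>R sgn d"
    using \<open>d \<noteq> 0\<close> by (simp add: sgn_div_norm)
  finally have "z \<in> line w (sgn d)"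
    by (auto simp: line_def)
  then have "infdist (x, y) (line w (sgn d)) \<le> dist (x, y) z"
    by (rule infdist_le)
  \<comment> \<open>The two coordinate errors of 1/4 add up to exactly the half-width of a
    strip.\<close>
  also have "\<dots> \<le> \<bar>x - fst z\<bar> + \<bar>y - snd z\<bar>"
    unfolding dist_Pair_Pair z_def dist_real_def fst_conv snd_conv
    using sqrt_sum_squares_le_sum_abs by simp
  also have "\<dots> \<le> 1/2"
    using assms(3,4) by (simp add: z_def)
  finally show ?thesis
    by (simp add: strip_def w_def d_def)
qed

text \<open>Over every \<open>x\<close> in an interval of length \<open>n^2 / 4\<close> stands one
  of the boxes, so the inner integral is at least 1/4 there.\<close>

lemma mixed_norm_ge_on_lattice_boxes:
  fixes F :: "real \<times> real \<Rightarrow> real"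
  assumes "q > 0" "r > 0" "n > 0"
    and F: "\<And>x y k l. \<lbrakk>0 \<le> k; k < int n; 0 \<le> l; l < int n;
      \<bar>x - of_int (int n * k + l) / 4\<bar> \<le> 1/4; \<bar>y - of_int (int n * l) / 4\<bar> \<le> 1/4\<rbrakk> \<Longrightarrow> F (x, y) \<ge> 1"
  shows "mixed_norm q r (cball (0, 0) (real n ^ 2)) F \<ge>
    ennreal (((1/4) powr (q / r) * (real n ^ 2 / 4)) powr (1 / q))"
proof -
  define B where "B = cball (0 :: real, 0 :: real) (real n ^ 2)"
  define G where "G x = (\<integral>\<^sup>+ y. ennreal (\<bar>F (x, y)\<bar> powr r * indicator B (x, y)) \<partial>lborel)" for x
  have G: "ennreal (1/4) \<le> G x" if x: "0 \<le> x" "x < real n ^ 2 / 4" for x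
  proof -
    define i where "i = \<lfloor>4 * x\<rfloor>"
    \<comment> \<open>The two digits of \<open>i\<close> in base \<open>n\<close> select the lattice
      point whose box lies over \<open>x\<close>.\<close>
    define k l where "k = i div int n" and "l = i mod int n"
    have i: "int n * k + l = i" by (simp add: k_def l_def)
    have "l \<ge> 0" using \<open>n > 0\<close> by (simp add: l_def)
    have xi: "of_int i \<le> 4 * x" "4 * x \<le> of_int i + 1" "0 \<le> i"
      using x by (auto simp: i_def)
    have "real_of_int i < real n ^ 2" using xi(1) x(2) by simp
    then have "of_int i < (of_int (int n * int n) :: real)" by (simp add: power2_eq_square)
    then have "i < int n * int n" by (simp only: of_int_less_iff)
    have "k < int n"
    proof (rule ccontr)
      assume "\<not> k < int n"
      then have "int n \<le> k" by simp
      then have "int n * int n \<le> int n * k" by (rule mult_left_mono) simp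
      then show False
        using i \<open>i < int n * int n\<close>  \<open>l \<ge> 0\<close> by linarith
    qed
    then have kl: "0 \<le> k" "k < int n" "0 \<le> l" "l < int n"
      using xi(3) \<open>n > 0\<close>
      by (auto simp: k_def l_def pos_imp_zdiv_nonneg_iff)
    define c where "c = real_of_int (int n * l) / 4"
    \<comment> \<open>Shows that the box reaches at most to height \<open>n^2 / 4\<close>. Together
      with the bound on \<open>x\<close> this puts it inside the disc, since
      \<open>n^2 / 4 + n^2 / 4 <= n^2\<close>.\<close>
    have "int n * l \<le> int n * (int n - 1)"
      using kl by (intro mult_left_mono) auto
    then have "int n * l + 1 \<le> int n * int n"
      using \<open>n > 0\<close> by (simp add: algebra_simps)
    then have "real_of_int (int n * l + 1) \<le> of_int (int n * int n)"
      by (simp only: of_int_le_iff)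
    then have c: "0 \<le> c" "c + 1/4 \<le> real n ^ 2 / 4"
      using kl by (auto simp: c_def power2_eq_square)
    have "ennreal (1 * ((c + 1/4) - c)) \<le> G x"
      unfolding G_def
    proof (rule nn_integral_ge_const_on_interval)
      fix y assume y: "c \<le> y" "y < c + 1/4"
      have "F (x, y) \<ge> 1"
        using xi y kl by (intro F[of k l]) (auto simp: i c_def)
      then have "\<bar>F (x, y)\<bar> powr r \<ge> 1"
        using \<open>r > 0\<close> by (intro ge_one_powr_ge_zero) auto
      moreover have "(x, y) \<in> B"
      proof -
        have "norm (x, y) \<le> \<bar>x\<bar> + \<bar>y\<bar>"
          unfolding norm_Pair real_norm_def power2_abs
          using sqrt_sum_squares_le_sum_abs by blast
        then show ?thesis
          using x y c by (auto simp: B_def simp flip: zero_prod_def)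
      qed
      ultimately show "ennreal 1 \<le> ennreal (\<bar>F (x, y)\<bar> powr r * indicator B (x, y))"
        by (simp add: ennreal_leI del: ennreal_1)
    qed auto
    then show ?thesis by simp
  qed
  have "ennreal ((1/4) powr (q / r) * (real n ^ 2 / 4 - 0)) \<le> (\<integral>\<^sup>+ x. epowr (G x) (q / r) \<partial>lborel)"
  proof (rule nn_integral_ge_const_on_interval)
    fix x assume "0 \<le> x" "x < real n ^ 2 / 4"
    from epowr_mono[OF G[OF this], of "q / r"]
    show "ennreal ((1/4) powr (q / r)) \<le> epowr (G x) (q / r)"
      using assms(1,2) by (simp add: epowr_ennreal)
  qed auto
  from epowr_mono[OF this, of "1 / q"] show ?thesis
    using \<open>q > 0\<close> by (simp add: epowr_ennreal mixed_norm_def G_def B_def)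
qed

section \<open>Comparison of the two growth rates in \<open>n\<close>\<close>

theorem theorem5p8:
  fixes m :: nat and p :: "nat \<Rightarrow> real" and q r \<theta> :: real and v :: "nat \<Rightarrow> real \<times> real"
  assumes "m \<ge> 1"
    and "\<forall>j\<in>{1..m}. p j > 0" and "q > 0" and "r > 0"
    and "(\<Sum>j=1..m. p j) = 1" and "1 / q + 1 / r = 1" and "q < 2"
    and "\<theta> > 0"
    and "\<forall>j\<in>{1..m}. v j \<in> sphere 0 1"
  shows "\<not> (\<forall>\<epsilon>::real>0. \<exists>C::ennreal. C < \<infinity> \<and>
    (\<forall>R::real>1. \<forall>c :: real \<times> real. \<forall>N :: nat \<Rightarrow> nat. \<forall>T :: nat \<Rightarrow> nat \<Rightarrow> (real \<times> real) set.
      (\<forall>j\<in>{1..m}. N j \<ge> 1) \<longrightarrow>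
      (\<forall>j\<in>{1..m}. \<forall>n\<in>{1..N j}. T j n \<in> strips_near \<theta> (v j)) \<longrightarrow>
      mixed_norm q r (cball c R)
        (\<lambda>z. \<Prod>j=1..m. (\<Sum>n=1..N j. indicator (T j n) z) powr p j)
      \<le> C * ennreal (R powr \<epsilon>) * ennreal (\<Prod>j=1..m. real (N j) powr p j)))"
proof
  assume H: "\<forall>\<epsilon>::real>0. \<exists>C::ennreal. C < \<infinity> \<and>
    (\<forall>R::real>1. \<forall>c :: real \<times> real. \<forall>N :: nat \<Rightarrow> nat. \<forall>T :: nat \<Rightarrow> nat \<Rightarrow> (real \<times> real) set.
      (\<forall>j\<in>{1..m}. N j \<ge> 1) \<longrightarrow>
      (\<forall>j\<in>{1..m}. \<forall>n\<in>{1..N j}. T j n \<in> strips_near \<theta> (v j)) \<longrightarrow>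
      mixed_norm q r (cball c R)
        (\<lambda>z. \<Prod>j=1..m. (\<Sum>n=1..N j. indicator (T j n) z) powr p j)
      \<le> C * ennreal (R powr \<epsilon>) * ennreal (\<Prod>j=1..m. real (N j) powr p j))"
  \<comment> \<open>The norm grows like \<open>n powr (2 / q) = n powr (1 + 2 * \<delta>)\<close>.
    With exponent \<open>\<delta> / 2\<close> and \<open>R = n^2\<close> the assumed bound grows
    only like \<open>n powr (1 + \<delta>)\<close>, as the number of strips is linear in
    \<open>n\<close>.\<close>
  define \<delta> where "\<delta> = 1 / q - 1 / 2"
  have "\<delta> > 0" using assms(3,7) by (simp add: \<delta>_def field_simps)
  then obtain C0 :: ennreal where "C0 < \<infinity>" and
    C0: "\<And>R c N T. R > 1 \<Longrightarrow> \<forall>j\<in>{1..m}. N j \<ge> 1 \<Longrightarrow>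
      \<forall>j\<in>{1..m}. \<forall>n\<in>{1..N j}. T j n \<in> strips_near \<theta> (v j) \<Longrightarrow>
      mixed_norm q r (cball c R)
        (\<lambda>z. \<Prod>j=1..m. (\<Sum>n=1..N j. indicator (T j n) z) powr p j)
      \<le> C0 * ennreal (R powr (\<delta> / 2)) * ennreal (\<Prod>j=1..m. real (N j) powr p j)"
    using H[rule_format, of "\<delta> / 2"] by auto
  define C where "C = enn2real C0"
  have C: "C \<ge> 0" "C0 = ennreal C"
    using \<open>C0 < \<infinity>\<close> by (auto simp: C_def)
  have "\<forall>j\<in>{1..m}. \<exists>ab :: int \<times> int. ab \<noteq> (0, 0) \<and> eventually (\<lambda>n::nat.
      angle (sgn (real_of_int (fst ab) + of_int (snd ab) / real n, of_int (snd ab))) (v j) < \<theta>) sequentially"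
  proof
    fix j assume "j \<in> {1..m}"
    then obtain a b where "(a, b) \<noteq> (0, 0)" "eventually (\<lambda>n::nat.
        angle (sgn (real_of_int a + of_int b / real n, of_int b)) (v j) < \<theta>) sequentially"
      using ex_integer_direction_near[of "v j" \<theta>] assms(8,9) by blast
    then show "\<exists>ab :: int \<times> int. ab \<noteq> (0, 0) \<and> eventually (\<lambda>n::nat.
        angle (sgn (real_of_int (fst ab) + of_int (snd ab) / real n, of_int (snd ab))) (v j) < \<theta>) sequentially"
      by (intro exI[of _ "(a, b)"]) simp
  qed
  from bchoice[OF this] obtain ab :: "nat \<Rightarrow> int \<times> int" where ab: "\<And>j. j \<in> {1..m} \<Longrightarrow> ab j \<noteq> (0, 0)"
    "\<And>j. j \<in> {1..m} \<Longrightarrow> eventually (\<lambda>n::nat. angle (sgn (real_of_int (fst (ab j)) +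
        of_int (snd (ab j)) / real n, of_int (snd (ab j)))) (v j) < \<theta>) sequentially"
    by blast
  \<comment> \<open>A single bound for all \<open>j\<close>, so that the same number
    \<open>N\<close> of strips can be used in every family.\<close>
  define A where "A = (\<Sum>j=1..m. \<bar>fst (ab j)\<bar> + \<bar>snd (ab j)\<bar>)"
  have A: "\<bar>fst (ab j)\<bar> + \<bar>snd (ab j)\<bar> \<le> A" if "j \<in> {1..m}" for j
    unfolding A_def using that by (intro member_le_sum) auto
  have "A \<ge> 0" unfolding A_def by (intro sum_nonneg) auto
  define c1 where "c1 = ((1/4) powr (q / r) * (1 / 4)) powr (1 / q)"
  have "c1 > 0" by (simp add: c1_def)
  have bound: "c1 * real n powr \<delta> \<le> C * of_int (2 * A + 1)"
    if n: "n \<ge> 2" and dir: "\<forall>j\<in>{1..m}. angle (sgn (real_of_int (fst (ab j)) +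
        of_int (snd (ab j)) / real n, of_int (snd (ab j)))) (v j) < \<theta>" for n :: nat
  proof -
    \<comment> \<open>The values \<open>b * k - a * l\<close> lie between \<open>-A * n\<close> and
      \<open>A * n\<close>, which makes at most \<open>2 * A * n + 1 <= (2 * A + 1) * n\<close>
      strips. The index \<open>i\<close> starts at 1 and stands for the value
      \<open>i - 1 - A * n\<close>.\<close>
    define N where "N = nat ((2 * A + 1) * int n)"
    define T where "T j i = strip
      ((of_int (int i - 1 - A * int n) / of_int (4 * ((fst (ab j))\<^sup>2 + (snd (ab j))\<^sup>2))) *\<^sub>R
        (of_int (int n * snd (ab j) - fst (ab j)), of_int (- int n * fst (ab j))))
      (sgn (real_of_int (fst (ab j)) + of_int (snd (ab j)) / real n, of_int (snd (ab j))))" for j i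
    have intN: "int N = (2 * A + 1) * int n"
      using \<open>A \<ge> 0\<close> by (simp add: N_def)
    have realN: "real N = of_int (2 * A + 1) * real n"
      using arg_cong[OF intN, of real_of_int] by simp
    have "N \<ge> 1"
      using intN n \<open>A \<ge> 0\<close> by (smt (verit) mult_pos_pos of_nat_0_less_iff of_nat_1 of_nat_le_iff zero_less_numeral)
    have T_near: "T j i \<in> strips_near \<theta> (v j)" if j: "j \<in> {1..m}" for j i
    proof -
      define d where "d = (real_of_int (fst (ab j)) + of_int (snd (ab j)) / real n, real_of_int (snd (ab j)))"
      have "d \<noteq> 0"
        using ab(1)[OF j] by (auto simp: d_def zero_prod_def prod_eq_iff)
      then have "sgn d \<in> sphere 0 1" by (simp add: norm_sgn)
      moreover have "angle (sgn d) (v j) < \<theta>" using dir j by (auto simp: d_def)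
      ultimately show ?thesis
        unfolding strips_near_def T_def d_def[symmetric] by blast
    qed
    define F where "F z = (\<Prod>j=1..m. (\<Sum>i=1..N. indicator (T j i) z) powr p j)" for z :: "real \<times> real"
    have "ennreal (((1/4) powr (q / r) * (real n ^ 2 / 4)) powr (1 / q)) \<le>
      mixed_norm q r (cball (0, 0) (real n ^ 2)) F"
    proof (rule mixed_norm_ge_on_lattice_boxes)
      fix x y :: real and k l :: int
      assume kl: "0 \<le> k" "k < int n" "0 \<le> l" "l < int n"
        and xy: "\<bar>x - of_int (int n * k + l) / 4\<bar> \<le> 1/4" "\<bar>y - of_int (int n * l) / 4\<bar> \<le> 1/4"
      show "1 \<le> F (x, y)"
        unfolding F_def
      \<comment> \<open>In each family some strip contains the point, so each sum, and hence each of
        its positive powers, is at least 1.\<close>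
      proof (rule prod_ge_1)
        fix j assume j: "j \<in> {1..m}"
        obtain a b where ab_j: "ab j = (a, b)" by force
        have "\<bar>b * k - a * l\<bar> \<le> \<bar>b * k\<bar> + \<bar>a * l\<bar>" by simp
        also have "\<dots> \<le> \<bar>b\<bar> * int n + \<bar>a\<bar> * int n"
          using kl by (auto simp: abs_mult intro!: add_mono mult_left_mono)
        also have "\<dots> = (\<bar>a\<bar> + \<bar>b\<bar>) * int n" by (simp add: algebra_simps)
        also have "\<dots> \<le> A * int n"
          using A[OF j] by (intro mult_right_mono) (auto simp: ab_j)
        finally have h: "\<bar>b * k - a * l\<bar> \<le> A * int n" .
        define i where "i = nat (b * k - a * l + 1 + A * int n)"
        have i: "int i = b * k - a * l + 1 + A * int n"
          using h by (simp add: i_def)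
        have "int i \<ge> 1" using h i by linarith
        moreover have "int i \<le> int N"
          using h n unfolding i intN by (simp add: algebra_simps)
        ultimately have iN: "i \<in> {1..N}" by simp
        have "(x, y) \<in> T j i"
          using strip_lattice_point[OF _ _ xy, of a b] ab(1)[OF j] n
          by (simp add: T_def ab_j i)
        then have "1 \<le> (indicator (T j i) (x, y) :: real)" by simp
        also have "\<dots> \<le> (\<Sum>i=1..N. indicator (T j i) (x, y))"
          using iN by (intro member_le_sum) auto
        finally show "1 \<le> (\<Sum>i=1..N. indicator (T j i) (x, y)) powr p j"
          using assms(2) j by (intro ge_one_powr_ge_zero) (auto simp: less_imp_le)
      qed
    qed (use assms n in auto)
    also have "\<dots> \<le> C0 * ennreal ((real n ^ 2) powr (\<delta> / 2)) * ennreal (\<Prod>j=1..m. real N powr p j)"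
      unfolding F_def
      using n \<open>N \<ge> 1\<close> T_near
      by (intro C0[where N = "\<lambda>_. N"]) (auto simp: one_less_power)
    \<comment> \<open>The exponents \<open>p j\<close> sum to 1.\<close>
    also have "(\<Prod>j=1..m. real N powr p j) = real N"
      using \<open>N \<ge> 1\<close> assms(5) by (simp add: powr_sum[symmetric])
    also have "C0 * ennreal ((real n ^ 2) powr (\<delta> / 2)) * ennreal (real N) =
      ennreal (C * real n powr \<delta> * real N)"
      using n C by (simp add: ennreal_mult powr_powr flip: powr_numeral)
    finally have "((1/4) powr (q / r) * (real n ^ 2 / 4)) powr (1 / q) \<le> C * real n powr \<delta> * real N"
      using C(1) by (subst (asm) ennreal_le_iff) auto
    moreover have "((1/4) powr (q / r) * (real n ^ 2 / 4)) powr (1 / q) = c1 * (real n ^ 2) powr (1 / q)"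
      by (simp add: c1_def powr_mult powr_divide)
    \<comment> \<open>By the choice of \<delta>, \<open>2 / q = 2 * \<delta> + 1\<close>. One factor
      \<open>n powr \<delta>\<close> and the factor \<open>n\<close> cancel against the upper bound;
      the other \<open>n powr \<delta>\<close> remains.\<close>
    moreover have "(real n ^ 2) powr (1 / q) = real n powr \<delta> * real n powr \<delta> * real n"
      using n by (simp add: \<delta>_def powr_powr flip: powr_numeral powr_add powr_mult_base)
        (simp add: powr_mult_base field_simps)
    ultimately have "(real n powr \<delta> * real n) * (c1 * real n powr \<delta>) \<le>
        (real n powr \<delta> * real n) * (C * of_int (2 * A + 1))"
      unfolding realN by (simp add: algebra_simps)
    then show ?thesis
      by (rule mult_left_le_imp_le) (use n in auto)
  qed
  \<comment> \<open>The right-hand side of \<open>bound\<close> does not depend on \<open>n\<close>,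
    whereas its left-hand side is unbounded.\<close>
  have "filterlim (\<lambda>n::nat. c1 * real n powr \<delta>) at_top sequentially"
    using \<open>c1 > 0\<close> \<open>\<delta> > 0\<close>
    by (intro filterlim_tendsto_pos_mult_at_top[OF tendsto_const]
        filterlim_compose[OF real_powr_at_top filterlim_real_sequentially]) auto
  then have "eventually (\<lambda>n::nat. c1 * real n powr \<delta> > C * of_int (2 * A + 1)) sequentially"
    by (simp add: filterlim_at_top_dense)
  moreover have "eventually (\<lambda>n::nat. \<forall>j\<in>{1..m}. angle (sgn (real_of_int (fst (ab j)) +
        of_int (snd (ab j)) / real n, of_int (snd (ab j)))) (v j) < \<theta>) sequentially"
    using ab(2) by (intro eventually_ball_finite) auto
  moreover note eventually_ge_at_top[of "2::nat"]
  ultimately have "eventually (\<lambda>n::nat. False) sequentially"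
    by eventually_elim (use bound in force)
  then show False by simp
qed

end
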